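(* There is a constant $C>0$ such that for any $k \geq 1$, any $k$-round adaptive algorithm that with constant probability outputs the minimum value of a (non-monotone) submodular function $f: 2^U \to [M]$ with $|U| = N$ requires $\Omega\!\left(\frac{N^2}{k^5 \log N}\right)$ queries to the evaluation oracle, even when $M \le C\, N^{k+1}$.
   Context: A set function $f: 2^U \to [M]$ is submodular if for all $A \subseteq B \subseteq U$ and every $i \notin B$, $f(A \cup \{i\}) - f(A) \geq f(B \cup \{i\}) - f(B)$. An evaluation oracle returns $f(S)$ on query $S \subseteq U$. An algorithm is $k$-round adaptive ($k$-adaptive) if it makes its oracle queries in at most $k$ rounds, where the queries within a round are issued in parallel (chosen based only on answers from previous rounds). *)

theory Defs
  imports "HOL-Probability.Probability_Mass_Function"
begin

definition submodular_on :: "nat set \<Rightarrow> (nat set \<Rightarrow> int) \<Rightarrow> bool" where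
  "submodular_on U f \<longleftrightarrow>
     (\<forall>A B i. A \<subseteq> B \<longrightarrow> B \<subseteq> U \<longrightarrow> i \<in> U \<longrightarrow> i \<notin> B \<longrightarrow>
        f (A \<union> {i}) - f A \<ge> f (B \<union> {i}) - f B)"

text \<open>Submodular functions from the subsets of \<open>U\<close> to \<open>[M] = {1, \<dots>, M}\<close>. Values are
  integers so that marginals may be negative; values of \<open>f\<close> outside \<open>Pow U\<close> are irrelevant.\<close>

definition submodular_functions :: "nat set \<Rightarrow> nat \<Rightarrow> (nat set \<Rightarrow> int) set" where
  "submodular_functions U M = {f. submodular_on U f \<and> f \<in> Pow U \<rightarrow> {1..int M}}"

text \<open>A transcript holds, for each completed round, the list of the queries of that round paired
  with the answers of the oracle. A deterministic algorithm chooses the queries of the next round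
  as a function of the transcript of all previous rounds only.\<close>

type_synonym transcript = "(nat set \<times> int) list list"

datatype det_alg =
  Det_Alg (next_queries: "transcript \<Rightarrow> nat set list") (final_output: "transcript \<Rightarrow> int")

text \<open>\<open>run A f k\<close> has exactly \<open>k\<close> rounds; since a round may be empty, this models algorithms
  using at most \<open>k\<close> rounds.\<close>

primrec run :: "det_alg \<Rightarrow> (nat set \<Rightarrow> int) \<Rightarrow> nat \<Rightarrow> transcript" where
  "run A f 0 = []"
| "run A f (Suc r) = run A f r @ [map (\<lambda>S. (S, f S)) (next_queries A (run A f r))]"

definition queries_made :: "det_alg \<Rightarrow> (nat set \<Rightarrow> int) \<Rightarrow> nat \<Rightarrow> nat set list" where
  "queries_made A f k = map fst (concat (run A f k))"

text \<open>A randomized algorithm draws all its random bits in advance, i.e. it is a probability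
  distribution on deterministic algorithms. Its query bound \<open>q\<close> is worst-case, on the total
  number of queries over all \<open>k\<close> rounds.\<close>

definition k_adaptive_with_queries ::
    "nat \<Rightarrow> nat \<Rightarrow> nat set \<Rightarrow> nat \<Rightarrow> det_alg pmf \<Rightarrow> bool" where
  "k_adaptive_with_queries k q U M D \<longleftrightarrow>
     (\<forall>A\<in>set_pmf D. \<forall>f\<in>submodular_functions U M.
        set (queries_made A f k) \<subseteq> Pow U \<and> length (queries_made A f k) \<le> q)"

definition outputs_minimum ::
    "nat \<Rightarrow> nat set \<Rightarrow> nat \<Rightarrow> real \<Rightarrow> det_alg pmf \<Rightarrow> bool" where
  "outputs_minimum k U M p D \<longleftrightarrow>
     (\<forall>f\<in>submodular_functions U M.
        measure_pmf.prob D {A. final_output A (run A f k) = Min (f ` Pow U)} \<ge> p)"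

end

theory Submission
  imports Defs
begin

text \<open>
  Cut \<open>k\<close> disjoint blocks \<open>D 0, D 1, \<dots>\<close> of size \<open>l = N div k\<close> out of \<open>U\<close> and hide a uniformly random set
  \<open>X \<subseteq> U\<close>. A query \<open>S\<close> is answered at the first block on which it differs from \<open>X\<close>, by a
  large penalty that does not depend on the later part of \<open>X\<close>; a query that agrees with \<open>X\<close> on all
  blocks is answered by a hidden value \<open>v\<close>, which is the minimum. A query made in round
  \<open>r\<close> without information about \<open>X \<inter> D r\<close> agrees with \<open>X\<close> on \<open>D r\<close> with
  probability \<open>2 ^ -l\<close>, so only one more block is uncovered per round and after \<open>k\<close> rounds
  \<open>v\<close> is still unknown, unless \<open>q\<close> is of order \<open>2 ^ l / k\<close>.
\<close>

section \<open>A single gate: submodularity and range\<close>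

text \<open>Adding an element of \<open>R\<close> lowers the penalty by \<open>L\<close> once \<open>S\<close> meets \<open>D - I\<close>, and raises it by
  \<open>L\<close> as long as \<open>I \<subseteq> S\<close> fails. A marginal of \<open>G\<close> lies between \<open>-L\<close> and \<open>L\<close>, so
  the marginals stay decreasing when \<open>S\<close> enters or leaves the sets with \<open>S \<inter> D = I\<close>.\<close>

definition gate ::
    "int \<Rightarrow> nat set \<Rightarrow> nat set \<Rightarrow> nat set \<Rightarrow> (nat set \<Rightarrow> int) \<Rightarrow> nat set \<Rightarrow> int" where
  "gate L D I R G S =
     (if S \<inter> D = I then G (S - D)
      else L * (of_bool (S \<inter> D - I \<noteq> {}) * (int (card R) + 1 - int (card (S - D)))
              + of_bool (I - S \<noteq> {}) * (int (card (S - D)) + 1)))"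

lemma gate_submodular:
  assumes fin: "finite R" and disj: "D \<inter> R = {}" and ID: "I \<subseteq> D" and finD: "finite D"
    and sub: "submodular_on R G" and rng: "\<And>S. S \<subseteq> R \<Longrightarrow> 0 \<le> G S \<and> G S \<le> L"
  shows "submodular_on (D \<union> R) (gate L D I R G)"
  unfolding submodular_on_def
proof (intro allI impI)
  fix A B i
  assume AB: "A \<subseteq> B" and B: "B \<subseteq> D \<union> R" and i: "i \<in> D \<union> R" "i \<notin> B"
  define n where "n = int (card R) + 1"
  define a where "a = int (card (A - D))"
  define b where "b = int (card (B - D))"
  have AR: "A - D \<subseteq> R" and BR: "B - D \<subseteq> R" using AB B by auto
  have finB: "finite (B - D)" using BR fin finite_subset by blast
  have L0: "0 \<le> L" using rng[of "{}"] by auto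
  have ab: "a \<le> b" unfolding a_def b_def using card_mono[OF finB, of "A - D"] AB by auto
  have bn: "b < n" unfolding b_def n_def using card_mono[OF fin BR] by auto
  have a0: "0 \<le> a" unfolding a_def by simp
  have GA: "0 \<le> G (A - D)" "G (A - D) \<le> L" and GB: "0 \<le> G (B - D)" "G (B - D) \<le> L"
    using rng AR BR by auto
  have step: "a + 1 \<le> b" if "A \<inter> D = B \<inter> D" "A \<noteq> B"
  proof -
    have "A - D \<subset> B - D" using that AB by blast
    from psubset_card_mono[OF finB this] show ?thesis unfolding a_def b_def by simp
  qed
  \<comment> \<open>The cases that enter or complete \<open>I\<close> compare values of
    \<open>G\<close>, not marginals. These differ by at most \<open>L\<close>; if \<open>B\<close>
    is strictly larger but equal on \<open>D\<close>, its extra elements lie outside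
    \<open>D\<close> and pay for that \<open>L\<close>.\<close>
  have slack: "G (A - D) - G (B - D) \<le> L * (b - a)" "G (B - D) - G (A - D) \<le> L * (b - a)"
    if "A \<inter> D = B \<inter> D"
  proof -
    have "A = B \<or> L * 1 \<le> L * (b - a)"
      using step[OF that] L0 by (metis add.commute le_diff_eq mult_left_mono)
    moreover have "A = B \<Longrightarrow> a = b" unfolding a_def b_def by simp
    ultimately show "G (A - D) - G (B - D) \<le> L * (b - a)" "G (B - D) - G (A - D) \<le> L * (b - a)"
      using GA GB by auto
  qed
  have La: "L * a \<le> L * b" "0 \<le> L * a" "L * (b + 1) \<le> L * n"
    using ab a0 bn L0 by (auto intro!: mult_left_mono)
  let ?F = "gate L D I R G"
  \<comment> \<open>\<open>x S\<close>: a wrong element of \<open>D\<close> is present;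
    \<open>y S\<close>: a right one is missing. As \<open>S\<close> grows, \<open>x\<close> can only
    switch on and \<open>y\<close> only off, which leaves few combinations to compare.\<close>
  define x where "x S \<longleftrightarrow> S \<inter> D - I \<noteq> {}" for S
  define y where "y S \<longleftrightarrow> I - S \<noteq> {}" for S
  have F: "?F S = (if x S \<or> y S
      then L * (of_bool (x S) * (n - int (card (S - D))) + of_bool (y S) * (int (card (S - D)) + 1))
      else G (S - D))" for S
    using ID unfolding gate_def x_def y_def n_def by (auto intro: arg_cong)
  have xm: "x A \<Longrightarrow> x B" and ym: "y B \<Longrightarrow> y A" using AB unfolding x_def y_def by auto
  consider "i \<in> R" "i \<notin> D" | "i \<in> D" "i \<notin> I" | "i \<in> I" using i disj by blast
  then show "?F (A \<union> {i}) - ?F A \<ge> ?F (B \<union> {i}) - ?F B"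
  proof cases
    case 1
    have eq: "x (S \<union> {i}) = x S" "y (S \<union> {i}) = y S" "(S \<union> {i}) - D = (S - D) \<union> {i}" for S
      using 1 ID unfolding x_def y_def by auto
    have ca: "int (card ((A - D) \<union> {i})) = a + 1"
      unfolding a_def using i AB finite_subset[OF AR fin] by (subst card_Un_disjoint) auto
    have cb: "int (card ((B - D) \<union> {i})) = b + 1"
      unfolding b_def using i finB by (subst card_Un_disjoint) auto
    define g where "g S = G ((S - D) \<union> {i}) - G (S - D)" for S
    have g: "g B \<le> g A" "- L \<le> g A" "g B \<le> L"
      using sub[unfolded submodular_on_def, rule_format, of "A - D" "B - D" i] AB BR 1 i GA GB
        rng[of "(A - D) \<union> {i}"] rng[of "(B - D) \<union> {i}"] AR unfolding g_def by auto
    \<comment> \<open>Growing \<open>S\<close> can move from only \<open>y\<close>, through both or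
      neither, to only \<open>x\<close>; the marginal runs through \<open>L\<close>, then 0 or
      \<open>g S\<close>, then \<open>- L\<close>.\<close>
    have "?F (S \<union> {i}) - ?F S = (if x S \<or> y S then L * (of_bool (y S) - of_bool (x S)) else g S)"
      if "int (card ((S - D) \<union> {i})) = int (card (S - D)) + 1" for S
      unfolding F eq that g_def
      by (cases "x S"; cases "y S") (simp_all add: algebra_simps)
    note marg = this[OF ca[unfolded a_def]] this[OF cb[unfolded b_def]]
    show ?thesis
      unfolding marg using xm ym g L0
      by (cases "x A"; cases "y A"; cases "x B"; cases "y B") simp_all
  next
    case 2
    have eq: "x (S \<union> {i}) = True" "y (S \<union> {i}) = y S" "(S \<union> {i}) - D = S - D" for S
      using 2 unfolding x_def y_def by auto
    have "A \<inter> D = B \<inter> D" if "\<not> x A" "\<not> y A" "\<not> x B" "\<not> y B"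
      using that ID unfolding x_def y_def by auto
    then have sl: "G (A - D) - G (B - D) \<le> L * b - L * a"
      if "\<not> x A" "\<not> y A" "\<not> x B" "\<not> y B"
      using slack(1) that by (simp add: right_diff_distrib)
    \<comment> \<open>Before \<open>x\<close> holds the marginal is at least 0, its value
      afterwards: the count from \<open>card R + 1\<close> leaves at least one \<open>L\<close>,
      which covers \<open>G\<close>.\<close>
    have "?F (S \<union> {i}) - ?F S = (if x S then 0
        else L * n - L * int (card (S - D)) - (if y S then 0 else G (S - D)))" for S
      unfolding F eq by (cases "x S"; cases "y S") (simp_all add: algebra_simps)
    note marg = this[of A, folded a_def] this[of B, folded b_def]
    show ?thesis
      unfolding marg using xm ym sl GA GB La(1,3)
      by (cases "x A"; cases "y A"; cases "x B"; cases "y B") (simp_all add: distrib_left)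
  next
    case 3
    have D: "i \<in> D" using 3 ID by auto
    define y' where "y' S \<longleftrightarrow> I - S - {i} \<noteq> {}" for S
    have eq: "x (S \<union> {i}) = x S" "y (S \<union> {i}) = y' S" "(S \<union> {i}) - D = S - D" for S
      using 3 D unfolding x_def y_def y'_def by auto
    have yAB: "y A" "y B" using 3 i AB unfolding y_def by auto
    have ym': "y' B \<Longrightarrow> y' A" using AB unfolding y'_def by auto
    have "A \<inter> D = B \<inter> D" if "\<not> x A" "\<not> y' A" "\<not> x B" "\<not> y' B"
      using that ID AB i unfolding x_def y'_def by blast
    then have sl: "G (B - D) - G (A - D) \<le> L * b - L * a"
      if "\<not> x A" "\<not> y' A" "\<not> x B" "\<not> y' B"
      using slack(2) that by (simp add: right_diff_distrib)
    \<comment> \<open>Completing \<open>I\<close> removes \<open>L * (card (S - D) + 1)\<close>; its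
      last \<open>L\<close> outweighs a value of \<open>G\<close>, so the marginal is at most the 0
      obtained while \<open>I\<close> stays incomplete.\<close>
    have "?F (S \<union> {i}) - ?F S = (if y' S then 0
        else (if x S then 0 else G (S - D)) - L * int (card (S - D)) - L)" if "y S" for S
      unfolding F eq using that by (cases "x S"; cases "y' S") (simp_all add: algebra_simps)
    note marg = this[OF yAB(1), folded a_def] this[OF yAB(2), folded b_def]
    show ?thesis
      unfolding marg using xm ym' sl GA GB L0 La(1,2)
      by (cases "x A"; cases "y' A"; cases "x B"; cases "y' B") simp_all
  qed
qed

text \<open>The coefficient of \<open>L\<close> lies between 1 and
  \<open>card (D \<union> R)\<close>. So a gate never undercuts the hidden value and costs one
  factor \<open>N\<close> in range.\<close>

lemma gate_bounds:
  assumes fin: "finite R" and disj: "D \<inter> R = {}" and ID: "I \<subseteq> D" and finD: "finite D"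
    and rng: "\<And>S. S \<subseteq> R \<Longrightarrow> v \<le> G S \<and> G S \<le> L" and v: "0 \<le> v"
    and S: "S \<subseteq> D \<union> R" and N: "int (card (D \<union> R)) \<le> N" "1 \<le> N"
  shows "v \<le> gate L D I R G S" "gate L D I R G S \<le> L * N"
proof -
  let ?P = "of_bool (S \<inter> D - I \<noteq> {}) * (int (card R) + 1 - int (card (S - D)))
              + of_bool (I - S \<noteq> {}) * (int (card (S - D)) + 1)"
  have SR: "S - D \<subseteq> R" using S by auto
  have c: "card (S - D) \<le> card R" using card_mono[OF fin SR] .
  have L: "v \<le> L" using rng[of "{}"] by auto
  have LN: "L * 1 \<le> L * N" using N L v by (intro mult_left_mono) auto
  have "v \<le> gate L D I R G S \<and> gate L D I R G S \<le> L * N"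
  proof (cases "S \<inter> D = I")
    case True
    then show ?thesis using rng[OF SR] LN by (auto simp: gate_def)
  next
    case False
    have cD: "card (D \<union> R) = card D + card R" using card_Un_disjoint[OF finD fin disj] .
    have "1 \<le> ?P" using False ID c by (cases "S \<inter> D - I = {}"; cases "I - S = {}") auto
    \<comment> \<open>With both penalties the counts add up to \<open>card R + 2\<close>, but then
      \<open>D\<close> has a missing right element and a present wrong one, hence at least two
      elements.\<close>
    moreover have "?P \<le> N"
    proof (cases "S \<inter> D - I \<noteq> {} \<and> I - S \<noteq> {}")
      case True
      then obtain x y where "x \<in> D" "y \<in> D" "x \<noteq> y" using ID by blast
      then have "card {x, y} \<le> card D" by (intro card_mono finD) auto
      then have "2 \<le> card D" using \<open>x \<noteq> y\<close> by simp
      then show ?thesis using True cD N by auto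
    next
      case F: False
      have "D \<noteq> {}" using False ID by auto
      then have "1 \<le> card D" using finD by (simp add: Suc_le_eq card_gt_0_iff)
      then show ?thesis using F cD N c by auto
    qed
    ultimately have "L * 1 \<le> L * ?P" "L * ?P \<le> L * N" using L v
      by (intro mult_left_mono; simp)+
    then show ?thesis using False L by (simp add: gate_def)
  qed
  then show "v \<le> gate L D I R G S" "gate L D I R G S \<le> L * N" by auto
qed

section \<open>The hard functions: gates nested over the blocks\<close>

text \<open>The multiplier \<open>V * int N ^ m\<close> is the upper bound for the inner function
  that \<open>gate_submodular\<close> demands as \<open>L\<close>.\<close>

primrec nested ::
    "int \<Rightarrow> nat \<Rightarrow> nat \<Rightarrow> (nat \<Rightarrow> nat set) \<Rightarrow> nat set \<Rightarrow> nat set \<Rightarrow> int \<Rightarrow> nat set \<Rightarrow> int" where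
  "nested V N 0 D U X v = (\<lambda>S. v)"
| "nested V N (Suc m) D U X v =
     gate (V * int N ^ m) (D 0) (X \<inter> D 0) (U - D 0) (nested V N m (\<lambda>i. D (Suc i)) (U - D 0) X v)"

text \<open>Submodularity and range go through one induction, because a gate is submodular only over
  an inner function of bounded range.\<close>

lemma nested_properties:
  assumes "finite U" "\<And>i. D i \<subseteq> U" "disjoint_family D" "0 \<le> v" "v \<le> V"
    "card U \<le> N" "1 \<le> N"
  shows "submodular_on U (nested V N m D U X v) \<and>
    (\<forall>S\<subseteq>U. v \<le> nested V N m D U X v S \<and> nested V N m D U X v S \<le> V * int N ^ m)"
  using assms
proof (induction m arbitrary: D U)
  case 0
  then show ?case by (simp add: submodular_on_def)
next
  case (Suc m)
  let ?D = "\<lambda>i. D (Suc i)"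
  let ?R = "U - D 0"
  have U: "D 0 \<union> ?R = U" using Suc.prems(2)[of 0] by auto
  have dj: "D (Suc i) \<inter> D 0 = {}" for i
    using Suc.prems(3) by (simp add: disjoint_family_on_def)
  have fD: "finite (D 0)" using Suc.prems(1,2) finite_subset by blast
  have cR: "card ?R \<le> N" using card_mono[of U ?R] Suc.prems(1,6) by auto
  have DR: "D (Suc i) \<subseteq> ?R" for i using Suc.prems(2)[of "Suc i"] dj by blast
  have df: "disjoint_family ?D" using Suc.prems(3) by (simp add: disjoint_family_on_def)
  note IH = Suc.IH[OF finite_Diff[OF Suc.prems(1)] DR df Suc.prems(4,5) cR Suc.prems(7)]
  have "submodular_on (D 0 \<union> ?R) (nested V N (Suc m) D U X v)"
    unfolding nested.simps
  proof (rule gate_submodular)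
    show "0 \<le> nested V N m ?D ?R X v S \<and> nested V N m ?D ?R X v S \<le> V * int N ^ m"
      if "S \<subseteq> ?R" for S
      using IH that Suc.prems(4) order_trans by blast
  qed (use IH Suc.prems(1) fD in auto)
  moreover have "v \<le> nested V N (Suc m) D U X v S"
       "nested V N (Suc m) D U X v S \<le> V * int N ^ m * int N" if "S \<subseteq> U" for S
    unfolding nested.simps
    by (rule gate_bounds[where v = v and N = "int N"];
        use IH Suc.prems(1,4-7) fD U that in simp)+
  ultimately show ?case unfolding U by (auto simp: algebra_simps)
qed

lemma nested_hits_min:
  assumes "disjoint_family D"
  shows "nested V N m D U X v X = v"
proof -
  \<comment> \<open>Generalized from \<open>X\<close> to \<open>Y\<close> because each gate strips
    its block from the query before passing it on.\<close>
  have "nested V N m D U X v Y = v" if "\<And>i. i < m \<Longrightarrow> Y \<inter> D i = X \<inter> D i" for Y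
    using that assms
  proof (induction m arbitrary: D U Y)
    case (Suc m)
    have dj: "D (Suc i) \<inter> D 0 = {}" for i
      using Suc.prems(2) by (simp add: disjoint_family_on_def)
    have "(Y - D 0) \<inter> D (Suc i) = X \<inter> D (Suc i)" if "i < m" for i
      using Suc.prems(1)[of "Suc i"] dj[of i] that by blast
    moreover have "disjoint_family (\<lambda>i. D (Suc i))"
      using Suc.prems(2) by (simp add: disjoint_family_on_def)
    ultimately have "nested V N m (\<lambda>i. D (Suc i)) (U - D 0) X v (Y - D 0) = v"
      by (intro Suc.IH) auto
    then show ?case using Suc.prems(1)[of 0] by (simp add: gate_def)
  qed simp
  then show ?thesis by simp
qed

text \<open>The answer comes from the first gate at which \<open>S\<close> fails, at index
  \<open>j\<close> or earlier. Its penalty reads only that block of the hidden set and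
  cardinalities, never the hidden value.\<close>

lemma nested_local:
  assumes "disjoint_family D" "j < m" "S \<inter> D j \<noteq> X \<inter> D j"
    "\<And>i. i \<le> j \<Longrightarrow> X \<inter> D i = Y \<inter> D i"
  shows "nested V N m D U X v S = nested V N m D U Y w S"
  using assms
proof (induction m arbitrary: D U S j)
  case (Suc m)
  have dj: "D (Suc i) \<inter> D 0 = {}" for i
    using Suc.prems(1) by (simp add: disjoint_family_on_def)
  have X0: "X \<inter> D 0 = Y \<inter> D 0" using Suc.prems(4) by simp
  show ?case
  proof (cases "S \<inter> D 0 = X \<inter> D 0")
    case True
    then obtain i where i: "j = Suc i" using Suc.prems(3) by (cases j) auto
    have "(S - D 0) \<inter> D (Suc i) = S \<inter> D (Suc i)" using dj[of i] by blast
    moreover have "disjoint_family (\<lambda>i. D (Suc i))"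
      using Suc.prems(1) by (simp add: disjoint_family_on_def)
    ultimately have "nested V N m (\<lambda>i. D (Suc i)) (U - D 0) X v (S - D 0)
        = nested V N m (\<lambda>i. D (Suc i)) (U - D 0) Y w (S - D 0)"
      using Suc.prems i by (intro Suc.IH[where j = i]) auto
    then show ?thesis using X0 by (simp add: gate_def)
  next
    case False
    moreover have "X \<inter> D 0 - S = Y \<inter> D 0 - S" using X0 by simp
    ultimately show ?thesis using X0 by (simp add: gate_def)
  qed
qed simp

section \<open>Runs with restricted information and the counting of lucky guesses\<close>

text \<open>The run in which the oracle has access to \<open>X \<inter> D i\<close> only for \<open>i \<le> r\<close> when it answers
  round \<open>r\<close>. Queries are cut off at \<open>q\<close> because the query bound of the algorithm says nothing about
  its behaviour on answers that come from no submodular function.\<close>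

primrec partial_run ::
    "det_alg \<Rightarrow> nat \<Rightarrow> (nat set \<Rightarrow> nat set \<Rightarrow> int) \<Rightarrow> (nat \<Rightarrow> nat set) \<Rightarrow> nat set \<Rightarrow> nat \<Rightarrow> transcript" where
  "partial_run A q F D X 0 = []"
| "partial_run A q F D X (Suc r) = partial_run A q F D X r @
     [map (\<lambda>S. (S, F (X \<inter> (\<Union>i\<le>r. D i)) S)) (take q (next_queries A (partial_run A q F D X r)))]"

lemma partial_run_cong:
  assumes "\<And>i. i < r \<Longrightarrow> X \<inter> D i = Y \<inter> D i"
  shows "partial_run A q F D X r = partial_run A q F D Y r"
  using assms
proof (induction r)
  case (Suc r)
  have "X \<inter> D i = Y \<inter> D i" if "i \<le> r" for i using Suc.prems that by simp
  then have "X \<inter> (\<Union>i\<le>r. D i) = Y \<inter> (\<Union>i\<le>r. D i)" by blast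
  then show ?case using Suc by simp
qed simp

text \<open>Stated for \<open>partial_run\<close>, so that the guesses of round \<open>r\<close> are
  fixed before \<open>X \<inter> D r\<close> has any influence.\<close>

definition lucky ::
    "det_alg \<Rightarrow> nat \<Rightarrow> (nat set \<Rightarrow> nat set \<Rightarrow> int) \<Rightarrow> (nat \<Rightarrow> nat set) \<Rightarrow> nat \<Rightarrow> nat set \<Rightarrow> bool" where
  "lucky A q F D r X \<longleftrightarrow>
     (\<exists>S\<in>set (take q (next_queries A (partial_run A q F D X r))). S \<inter> D r = X \<inter> D r)"

text \<open>Once \<open>X - D r\<close> is fixed, so are the queries of round \<open>r\<close>, and
  each of the at most \<open>q\<close> queries matches one choice of
  \<open>X \<inter> D r\<close>.\<close>

lemma card_lucky:
  assumes U: "finite U" and D: "\<And>i. D i \<subseteq> U" "disjoint_family D"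
  shows "card {X \<in> Pow U. lucky A q F D r X} \<le> q * 2 ^ (card U - card (D r))"
proof -
  let ?Q = "\<lambda>Y. take q (next_queries A (partial_run A q F D Y r))"
  have "{X \<in> Pow U. lucky A q F D r X}
        \<subseteq> (\<Union>Y\<in>Pow (U - D r). (\<lambda>S. Y \<union> (S \<inter> D r)) ` set (?Q Y))"
  proof
    fix X assume "X \<in> {X \<in> Pow U. lucky A q F D r X}"
    then obtain S where X: "X \<subseteq> U" and S: "S \<in> set (?Q X)" "S \<inter> D r = X \<inter> D r"
      by (auto simp: lucky_def)
    \<comment> \<open>Earlier blocks are disjoint from \<open>D r\<close>, so erasing
      \<open>D r\<close> from \<open>X\<close> leaves the transcript before round \<open>r\<close>
      unchanged.\<close>
    have "(X - D r) \<inter> D i = X \<inter> D i" if "i < r" for i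
      using disjoint_family_onD[OF D(2), of i r] that by auto
    then have "?Q X = ?Q (X - D r)" using partial_run_cong[of r X D "X - D r"] by simp
    then have "S \<in> set (?Q (X - D r))" using S(1) by simp
    moreover have "X = (X - D r) \<union> (S \<inter> D r)" using S(2) by auto
    moreover have "X - D r \<in> Pow (U - D r)" using X by auto
    ultimately show "X \<in> (\<Union>Y\<in>Pow (U - D r). (\<lambda>S. Y \<union> (S \<inter> D r)) ` set (?Q Y))" by blast
  qed
  then have "card {X \<in> Pow U. lucky A q F D r X}
        \<le> card (\<Union>Y\<in>Pow (U - D r). (\<lambda>S. Y \<union> (S \<inter> D r)) ` set (?Q Y))"
    using U by (intro card_mono) auto
  also have "\<dots> \<le> (\<Sum>Y\<in>Pow (U - D r). card ((\<lambda>S. Y \<union> (S \<inter> D r)) ` set (?Q Y)))"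
    using U by (intro card_UN_le) auto
  also have "\<dots> \<le> (\<Sum>Y\<in>Pow (U - D r). q)"
  proof (rule sum_mono)
    fix Y
    have "card ((\<lambda>S. Y \<union> (S \<inter> D r)) ` set (?Q Y)) \<le> card (set (?Q Y))" by (intro card_image_le) simp
    also have "\<dots> \<le> length (?Q Y)" by (rule card_length)
    also have "\<dots> \<le> q" by simp
    finally show "card ((\<lambda>S. Y \<union> (S \<inter> D r)) ` set (?Q Y)) \<le> q" .
  qed
  also have "\<dots> = q * 2 ^ (card U - card (D r))"
    using U D(1) finite_subset[OF D(1) U] by (simp add: card_Pow card_Diff_subset)
  finally show ?thesis .
qed

text \<open>Without a lucky guess every query of round \<open>r\<close> differs from
  \<open>X\<close> on \<open>D r\<close>, so the true oracle answers it from the blocks up to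
  \<open>r\<close>. The query bound makes the cut-off at \<open>q\<close> harmless.\<close>

lemma run_eq_partial_run:
  assumes loc: "\<And>r S. r < k \<Longrightarrow> S \<inter> D r \<noteq> X \<inter> D r \<Longrightarrow> f S = F (X \<inter> (\<Union>i\<le>r. D i)) S"
    and len: "length (queries_made A f k) \<le> q"
    and unlucky: "\<And>r. r < k \<Longrightarrow> \<not> lucky A q F D r X" and r: "r \<le> k"
  shows "run A f r = partial_run A q F D X r"
  using r
proof (induction r)
  case (Suc r)
  let ?Q = "next_queries A (run A f r)"
  have pre: "length (concat (run A f s)) \<le> length (concat (run A f t))" if "s \<le> t" for s t
    using that by (induction t rule: dec_induct) auto
  have "length ?Q \<le> length (concat (run A f (Suc r)))" by simp
  also have "\<dots> \<le> q" using pre[OF Suc.prems] len by (simp add: queries_made_def)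
  finally have t: "take q ?Q = ?Q" by simp
  have IH: "run A f r = partial_run A q F D X r" using Suc by simp
  have "f S = F (X \<inter> (\<Union>i\<le>r. D i)) S" if "S \<in> set ?Q" for S
    using unlucky[of r] loc[of r S] that t Suc.prems by (auto simp: lucky_def IH)
  then show ?case using t by (simp add: IH)
qed simp

text \<open>A lucky \<open>X\<close> may be correct for all \<open>V\<close> values. For any other
  \<open>X\<close> the transcript is independent of \<open>v\<close>, so the output fits at most one
  \<open>v\<close>, as \<open>g\<close> is injective.\<close>

lemma card_correct_le:
  fixes V k q :: nat
  assumes U: "finite U" and D: "\<And>i. D i \<subseteq> U" "disjoint_family D" "\<And>i. i < k \<Longrightarrow> card (D i) = l"
    and loc: "\<And>r S X v. r < k \<Longrightarrow> S \<inter> D r \<noteq> X \<inter> D r \<Longrightarrow> f X v S = F (X \<inter> (\<Union>i\<le>r. D i)) S"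
    and len: "\<And>X v. X \<subseteq> U \<Longrightarrow> v < V \<Longrightarrow> length (queries_made A (f X v) k) \<le> q"
    and g: "inj g"
  shows "card {(X, v). X \<subseteq> U \<and> v < V \<and> final_output A (run A (f X v) k) = g v}
           \<le> k * (q * 2 ^ (card U - l)) * V + 2 ^ card U"
proof -
  let ?bad = "\<lambda>X. \<exists>r<k. lucky A q F D r X"
  let ?B = "{X \<in> Pow U. ?bad X}"
  let ?out = "\<lambda>X. final_output A (partial_run A q F D X k)"
  have "{(X, v). X \<subseteq> U \<and> v < V \<and> final_output A (run A (f X v) k) = g v}
        \<subseteq> ?B \<times> {..<V} \<union> (\<lambda>X. (X, inv g (?out X))) ` Pow U" (is "?L \<subseteq> ?M")
  proof (intro subsetI)
    fix z assume "z \<in> ?L"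
    then obtain X v where z: "z = (X, v)" and X: "X \<subseteq> U" "v < V"
      and out: "final_output A (run A (f X v) k) = g v" by auto
    show "z \<in> ?M"
    proof (cases "?bad X")
      case False
      have "run A (f X v) k = partial_run A q F D X k"
      proof (rule run_eq_partial_run)
        show "f X v S = F (X \<inter> (\<Union>i\<le>r. D i)) S" if "r < k" "S \<inter> D r \<noteq> X \<inter> D r" for r S
          using loc that .
      qed (use len[OF X] False in auto)
      then have "v = inv g (?out X)" using out g by simp
      then show ?thesis using z X by auto
    qed (use z X in auto)
  qed
  then have "card ?L \<le> card ?M" using U by (intro card_mono) auto
  also have "\<dots> \<le> card (?B \<times> {..<V}) + card ((\<lambda>X. (X, inv g (?out X))) ` Pow U)"
    by (rule card_Un_le)
  also have "card ((\<lambda>X. (X, inv g (?out X))) ` Pow U) \<le> 2 ^ card U"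
    using card_image_le[of "Pow U"] U by (simp add: card_Pow)
  also have "card (?B \<times> {..<V}) = card ?B * V" by (simp add: card_cartesian_product)
  also have "card ?B \<le> k * (q * 2 ^ (card U - l))"
  proof -
    have "?B = (\<Union>r\<in>{..<k}. {X \<in> Pow U. lucky A q F D r X})" by auto
    then have "card ?B \<le> (\<Sum>r<k. card {X \<in> Pow U. lucky A q F D r X})"
      using card_UN_le[of "{..<k}"] by simp
    also have "\<dots> \<le> (\<Sum>r<k. q * 2 ^ (card U - l))"
      using card_lucky[OF U D(1,2), where A = A and q = q and F = F] D(3)
      by (intro sum_mono) (metis lessThan_iff)
    finally show ?thesis by simp
  qed
  finally show ?thesis by simp
qed

section \<open>Averaging over the hard family\<close>

text \<open>The averaging half of Yao's principle: the sum is the expected number of instances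
  solved, and each deterministic algorithm in the support solves at most \<open>b\<close>.\<close>

lemma sum_prob_le:
  fixes D :: "'a pmf" and I :: "'b set"
  assumes I: "finite I" and c: "\<And>a. a \<in> set_pmf D \<Longrightarrow> card {i \<in> I. P i a} \<le> b"
  shows "(\<Sum>i\<in>I. measure_pmf.prob D {a. P i a}) \<le> real b"
proof -
  have int: "integrable (measure_pmf D) (indicator {a. P i a} :: 'a \<Rightarrow> real)" for i
    by (intro measure_pmf.integrable_const_bound[where B = 1]) auto
  have "(\<Sum>i\<in>I. measure_pmf.prob D {a. P i a})
      = (\<Sum>i\<in>I. measure_pmf.expectation D (indicator {a. P i a}))" by simp
  also have "\<dots> = measure_pmf.expectation D (\<lambda>a. \<Sum>i\<in>I. indicator {a. P i a} a)"
    by (rule Bochner_Integration.integral_sum[symmetric]) (rule int)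
  also have "\<dots> \<le> real b"
  proof (rule measure_pmf.integral_le_const)
    show "integrable (measure_pmf D) (\<lambda>a. \<Sum>i\<in>I. indicator {a. P i a} a :: real)"
      using int by (intro Bochner_Integration.integrable_sum) auto
    have "(\<Sum>i\<in>I. indicator {a. P i a} a :: real) = real (card {i \<in> I. P i a})" for a
      using I by (simp add: indicator_def sum.If_cases Int_def)
    then show "AE a in measure_pmf D. (\<Sum>i\<in>I. indicator {a. P i a} a) \<le> real b"
      using c by (auto simp: AE_measure_pmf_iff)
  qed
  finally show ?thesis .
qed

text \<open>Averages over all \<open>2 ^ N * N\<close> pairs of hidden set and hidden value. The
  first term accounts for lucky guesses of a block, the second for a blind guess among
  \<open>N\<close> values.\<close>

lemma success_probability_le:
  fixes N k q :: nat
  assumes U: "finite U" "card U = N" and N: "1 \<le> N"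
    and bound: "k_adaptive_with_queries k q U (N ^ (k + 1) + 1) E"
    and out: "outputs_minimum k U (N ^ (k + 1) + 1) p E"
  shows "p \<le> real k * real q / 2 ^ (N div k) + 1 / real N"
proof -
  define l where "l = N div k"
  obtain h where h: "bij_betw h {..<N} U"
    using ex_bij_betw_nat_finite[OF U(1)] U(2) atLeast0LessThan by auto
  \<comment> \<open>The intersection with \<open>{..<N}\<close> keeps blocks of every index inside
    \<open>U\<close>, while the first \<open>k\<close> blocks still have full size
    \<open>l\<close>.\<close>
  define D where "D i = h ` ({i * l..<i * l + l} \<inter> {..<N})" for i
  have DU: "D i \<subseteq> U" for i using h by (auto simp: D_def bij_betw_def)
  have ord: "{i * l..<i * l + l} \<inter> {j * l..<j * l + l} = {}" if "i < j" for i j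
  proof -
    have "i * l + l \<le> j * l" using that mult_le_mono1[of "Suc i" j l] by simp
    then show ?thesis by auto
  qed
  have dj: "disjoint_family D"
    unfolding disjoint_family_on_def
  proof (intro ballI impI)
    fix i j :: nat assume "i \<noteq> j"
    then have e: "{i * l..<i * l + l} \<inter> {j * l..<j * l + l} = {}"
      using ord[of i j] ord[of j i] by (cases i j rule: linorder_cases) auto
    have "D i \<inter> D j = h ` (({i * l..<i * l + l} \<inter> {..<N}) \<inter> ({j * l..<j * l + l} \<inter> {..<N}))"
      unfolding D_def using h
      by (intro inj_on_image_Int[symmetric, where C = "{..<N}"]) (auto simp: bij_betw_def)
    also have "\<dots> = {}" using e by auto
    finally show "D i \<inter> D j = {}" .
  qed
  have cD: "card (D i) = l" if "i < k" for i
  proof -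
    have "i * l + l \<le> k * l" using that mult_le_mono1[of "Suc i" k l] by simp
    also have "\<dots> \<le> N" by (simp add: l_def)
    finally have "{i * l..<i * l + l} \<inter> {..<N} = {i * l..<i * l + l}" by auto
    moreover have "inj_on h ({i * l..<i * l + l} \<inter> {..<N})"
      using h by (auto simp: bij_betw_def intro: inj_on_subset)
    ultimately show ?thesis by (simp add: D_def card_image)
  qed
  \<comment> \<open>The shift by 1 moves the range \<open>0..N ^ (k + 1)\<close> into
    \<open>[M]\<close>.\<close>
  define f where "f X v S = nested (int N) N k D U X (int v) S + 1" for X v S
  have props: "submodular_on U (nested (int N) N k D U X (int v))"
       "\<And>S. S \<subseteq> U \<Longrightarrow> int v \<le> nested (int N) N k D U X (int v) S
          \<and> nested (int N) N k D U X (int v) S \<le> int N * int N ^ k"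
    if "v < N" for X v
    using nested_properties[OF U(1) DU dj, of "int v" "int N" N k X] that U N by auto
  have fam: "f X v \<in> submodular_functions U (N ^ (k + 1) + 1)" if "v < N" for X v
  proof -
    have "submodular_on U (f X v)"
      using props(1)[OF that, of X] by (simp add: submodular_on_def f_def)
    moreover have "f X v S \<in> {1..int (N ^ (k + 1) + 1)}" if "S \<subseteq> U" for S
      using props(2)[OF \<open>v < N\<close> that, of X] by (simp add: f_def)
    ultimately show ?thesis by (simp add: submodular_functions_def Pi_def)
  qed
  have min: "Min (f X v ` Pow U) = int v + 1" if "v < N" "X \<subseteq> U" for X v
  proof (rule Min_eqI)
    show "int v + 1 \<in> f X v ` Pow U"
      using that by (intro image_eqI[where x = X]) (auto simp: f_def nested_hits_min[OF dj])
  qed (use U props(2)[OF that(1)] in \<open>auto simp: f_def\<close>)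
  \<comment> \<open>The 0 is a placeholder: at a failed gate the hidden value does not enter the
    answer.\<close>
  define F where "F X S = nested (int N) N k D U X 0 S + 1" for X S
  have loc: "f X v S = F (X \<inter> (\<Union>i\<le>r. D i)) S" if "r < k" "S \<inter> D r \<noteq> X \<inter> D r" for r S X v
  proof -
    have "X \<inter> D i = X \<inter> (\<Union>i\<le>r. D i) \<inter> D i" if "i \<le> r" for i using that by blast
    then show ?thesis unfolding f_def F_def using nested_local[OF dj that] by simp
  qed
  let ?I = "Pow U \<times> {..<N}"
  let ?P = "\<lambda>(X, v) A. final_output A (run A (f X v) k) = int v + 1"
  have "real (2 ^ N * N) * p = (\<Sum>z\<in>?I. p)" using U by (simp add: card_cartesian_product card_Pow)
  also have "\<dots> \<le> (\<Sum>z\<in>?I. measure_pmf.prob E {A. ?P z A})"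
  proof (rule sum_mono)
    fix z assume "z \<in> ?I"
    then obtain X v where z: "z = (X, v)" "X \<subseteq> U" "v < N" by auto
    show "p \<le> measure_pmf.prob E {A. ?P z A}"
      using out[unfolded outputs_minimum_def, rule_format, OF fam[OF z(3), of X]] min[OF z(3,2)] z(1)
      by simp
  qed
  also have "\<dots> \<le> real (k * (q * 2 ^ (N - l)) * N + 2 ^ N)"
  proof (rule sum_prob_le)
    fix A assume A: "A \<in> set_pmf E"
    have "card {(X, v). X \<subseteq> U \<and> v < N \<and> final_output A (run A (f X v) k) = int v + 1}
           \<le> k * (q * 2 ^ (card U - l)) * N + 2 ^ card U"
    proof (rule card_correct_le[where f = f and F = F and D = D and g = "\<lambda>v. int v + 1"])
      show "f X v S = F (X \<inter> (\<Union>i\<le>r. D i)) S" if "r < k" "S \<inter> D r \<noteq> X \<inter> D r" for r S X v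
        using loc that .
      fix X v assume "v < N"
      show "length (queries_made A (f X v) k) \<le> q"
        using bound A fam[OF \<open>v < N\<close>, of X] by (auto simp: k_adaptive_with_queries_def)
    qed (auto simp: inj_def U dj cD DU[THEN subsetD])
    moreover have "{z \<in> ?I. ?P z A}
        = {(X, v). X \<subseteq> U \<and> v < N \<and> final_output A (run A (f X v) k) = int v + 1}" by auto
    ultimately show "card {z \<in> ?I. ?P z A} \<le> k * (q * 2 ^ (N - l)) * N + 2 ^ N" using U by simp
  qed (use U in auto)
  finally have *: "2 ^ N * real N * p \<le> real k * (real q * 2 ^ (N - l)) * real N + 2 ^ N" by simp
  have "(2::real) ^ (N - l) = 2 ^ N / 2 ^ l"
    by (rule power_diff) (auto simp: l_def)
  then have "2 ^ N * real N * p \<le> 2 ^ N * real N * (real k * real q / 2 ^ l + 1 / real N)"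
    using * N by (simp add: algebra_simps)
  then show ?thesis using N by (simp add: l_def)
qed

section \<open>From the exponential bound to the quadratic one\<close>

text \<open>Doubling the right side suffices when
  \<open>(l + 2)\<^sup>2 \<le> 2 * (l + 1)\<^sup>2\<close>, that is, when
  \<open>2 \<le> l * l\<close>; the steps from 0 and 1 are checked directly.\<close>

lemma Suc_square_le: "(l + 1)\<^sup>2 \<le> 4 * 2 ^ l" for l :: nat
proof (induction l)
  case (Suc l)
  show ?case
  proof (cases "l < 2")
    case True
    then have "l = 0 \<or> l = 1" by auto
    then show ?thesis by (auto simp: power2_eq_square)
  next
    case False
    then have "2 \<le> l * l" using mult_le_mono[of 2 l 1 l] by linarith
    then have "(Suc l + 1)\<^sup>2 \<le> 2 * (l + 1)\<^sup>2" by (simp add: power2_eq_square)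
    with Suc show ?thesis by simp
  qed
qed simp

theorem theorem7p1:
  "\<exists>C::real. C > 0 \<and>
     (\<forall>p::real. 0 < p \<and> p \<le> 1 \<longrightarrow>
       (\<exists>(c::real) (N0::nat). c > 0 \<and>
         (\<forall>(k::nat) (N::nat). k \<ge> 1 \<and> N \<ge> N0 \<longrightarrow>
           (\<exists>M::nat. real M \<le> C * real N ^ (k + 1) \<and>
             (\<forall>(U::nat set) (D::det_alg pmf) (q::nat).
                finite U \<and> card U = N \<and>
                k_adaptive_with_queries k q U M D \<and>
                outputs_minimum k U M p D
                \<longrightarrow> real q \<ge> c * (real N ^ 2 / (real k ^ 5 * ln (real N))))))))"
proof (rule exI[of _ 2], intro conjI allI impI)
  fix p :: real assume p: "0 < p \<and> p \<le> 1"
  \<comment> \<open>Exceeding \<open>2 / p\<close> keeps the blind guess \<open>1 / N\<close> below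
    \<open>p / 2\<close>; the summand 3 gives \<open>exp 1 \<le> N\<close>, hence
    \<open>ln N \<ge> 1\<close>.\<close>
  define N0 where "N0 = nat \<lceil>2 / p\<rceil> + 3"
  have main: "\<exists>M::nat. real M \<le> 2 * real N ^ (k + 1) \<and>
             (\<forall>(U::nat set) (D::det_alg pmf) (q::nat).
                finite U \<and> card U = N \<and>
                k_adaptive_with_queries k q U M D \<and>
                outputs_minimum k U M p D
                \<longrightarrow> real q \<ge> p / 8 * (real N ^ 2 / (real k ^ 5 * ln (real N))))"
    if kN: "k \<ge> 1" "N \<ge> N0" for k N :: nat
  proof (intro exI[of _ "N ^ (k + 1) + 1"] conjI allI impI)
    have N3: "3 \<le> N" using kN by (simp add: N0_def)
    then show "real (N ^ (k + 1) + 1) \<le> 2 * real N ^ (k + 1)" using one_le_power[of "real N" "k + 1"] by simp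
    fix U :: "nat set" and D :: "det_alg pmf" and q :: nat
    assume h: "finite U \<and> card U = N \<and> k_adaptive_with_queries k q U (N ^ (k + 1) + 1) D \<and>
                outputs_minimum k U (N ^ (k + 1) + 1) p D"
    let ?l = "N div k"
    have N2: "2 / p < real N" using kN by (simp add: N0_def) linarith
    then have "1 / real N < p / 2" using p N3 by (simp add: field_simps)
    moreover have "p \<le> real k * real q / 2 ^ ?l + 1 / real N"
      using success_probability_le[of U N k q D p] h N3 by simp
    ultimately have "p / 2 \<le> real k * real q / 2 ^ ?l" by linarith
    then have l: "p / 2 * 2 ^ ?l \<le> real k * real q" by (simp add: field_simps)
    \<comment> \<open>Rounding down in \<open>N div k\<close> loses less than one element per
      block.\<close>
    have "N \<le> k * (?l + 1)" using kN(1)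
      by (metis Suc_eq_plus1 dividend_less_times_div less_imp_le_nat mult_Suc_right
          zero_less_one order_less_le_trans)
    then have "N\<^sup>2 \<le> k\<^sup>2 * (?l + 1)\<^sup>2" by (metis power_mono power_mult_distrib zero_le)
    also have "\<dots> \<le> k\<^sup>2 * (4 * 2 ^ ?l)" by (intro mult_left_mono Suc_square_le) simp
    finally have "real (N\<^sup>2) \<le> real (k\<^sup>2 * (4 * 2 ^ ?l))" by (rule of_nat_mono)
    \<comment> \<open>The constant \<open>p / 8\<close> is the remaining success probability
      \<open>p / 2\<close> divided by the 4 of \<open>Suc_square_le\<close>.\<close>
    then have "p / 8 * (real N)\<^sup>2 \<le> p / 8 * (real k ^ 2 * (4 * 2 ^ ?l))"
      using p by (intro mult_left_mono) simp_all
    also have "\<dots> = real k ^ 2 * (p / 2 * 2 ^ ?l)" by simp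
    also have "\<dots> \<le> real k ^ 2 * (real k * real q)" by (intro mult_left_mono l) simp
    also have "\<dots> = real q * real k ^ 3" by (simp add: power2_eq_square power3_eq_cube)
    \<comment> \<open>The argument yields order \<open>N\<^sup>2 / k ^ 3\<close>; the claim is
      weaker by the factor \<open>k\<^sup>2 * ln N \<ge> 1\<close>.\<close>
    also have "\<dots> \<le> real q * (real k ^ 5 * ln (real N))"
    proof (rule mult_left_mono)
      have "exp 1 \<le> real N" using exp_le N3 by linarith
      then have "1 \<le> ln (real N)" using N3 by (simp add: ln_ge_iff)
      moreover have "real k ^ 3 \<le> real k ^ 5" using kN by (intro power_increasing) auto
      ultimately show "real k ^ 3 \<le> real k ^ 5 * ln (real N)"
        by (metis mult.right_neutral mult_left_mono of_nat_0_le_iff order_trans zero_le_power)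
    qed simp
    finally have "p / 8 * (real N)\<^sup>2 \<le> real q * (real k ^ 5 * ln (real N))" .
    moreover have "0 < real k ^ 5 * ln (real N)" using kN N3 by simp
    ultimately show "real q \<ge> p / 8 * (real N ^ 2 / (real k ^ 5 * ln (real N)))"
      by (simp add: pos_divide_le_eq)
  qed
  show "\<exists>(c::real) (N0::nat). c > 0 \<and>
         (\<forall>(k::nat) (N::nat). k \<ge> 1 \<and> N \<ge> N0 \<longrightarrow>
           (\<exists>M::nat. real M \<le> 2 * real N ^ (k + 1) \<and>
             (\<forall>(U::nat set) (D::det_alg pmf) (q::nat).
                finite U \<and> card U = N \<and>
                k_adaptive_with_queries k q U M D \<and>
                outputs_minimum k U M p D
                \<longrightarrow> real q \<ge> c * (real N ^ 2 / (real k ^ 5 * ln (real N))))))"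
    using main p by (intro exI[of _ "p / 8"] exI[of _ N0]) auto
qed simp

end
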